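(* Let $P$ be an Mtk on a countably generated measurable space $(\mathsf X,\mathcal B)$ such that $T(P)\neq\emptyset$, and let $\Pi$ denote its stationary distribution. Then \[ \rho^*_{\mathrm{opt}}(P)\;\ge\;\inf_{C\in\mathcal B:\ \Pi(C)>0}\Big[(1-\varepsilon_C)^{\lfloor 1/\Pi(C)\rfloor^{-1}}\Big]. \]
   Context: An Mtk (Markov transition kernel) is a Markov transition kernel $P:\mathsf X\times\mathcal B\to[0,1]$ on a countably generated measurable space $(\mathsf X,\mathcal B)$. Write $Pf(x)=\int_{\mathsf X}P(x,\mathrm dy)f(y)$, $P^m$ for the $m$-step kernel, and $\delta_xP^m=P^m(x,\cdot)$. Total variation distance: $d_{\mathrm{TV}}(\mu,\nu)=\sup_{A\in\mathcal B}[\mu(A)-\nu(A)]$. If $P$ has stationary probability measure $\Pi$, its convergence rate is \[ \rho_*(P)=\exp\Big[\sup_{x\in\mathsf X}\limsup_{m\to\infty}\frac{\log d_{\mathrm{TV}}(\delta_xP^m,\Pi)}{m}\Big]\in[0,1] \] (with $\log 0=-\infty$, $\exp(-\infty)=0$). Let $T_0=[0,1)\times[1,\infty)\times(0,1]\times(0,1]$. $P$ satisfies (A1)-(A3) with parameter $(\lambda,K,\varepsilon,\beta)\in T_0$ if there are $C\in\mathcal B$, a measurable $V:\mathsf X\to[1,\infty)$ and a probability measure $\nu$ on $\mathcal B$ such that: (A1) $PV(x)\le\lambda V(x)1_{\mathsf X\setminus C}(x)+K1_C(x)$ for all $x\in\mathsf X$; (A2) $P(x,A)\ge\varepsilon\nu(A)$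 for all $x\in C$, $A\in\mathcal B$; (A3) $\nu(C)\ge\beta$. It is known that (A1)-(A3) imply that $P$ has a unique stationary distribution $\Pi$ and $\rho_*(P)<1$. Let $T(P)\subset T_0$ be the set of all parameters with which $P$ satisfies (A1)-(A3). $P$ is reversible if $\int g\,Pf\,\mathrm d\Pi=\int f\,Pg\,\mathrm d\Pi$ for all $f,g\in L^2(\Pi)$, and non-negative definite if $\int f\,Pf\,\mathrm d\Pi\ge0$ for all $f\in L^2(\Pi)$. For $(\lambda,K,\varepsilon,\beta)\in T_0$ let $S_{\lambda,K,\varepsilon,\beta}$ be the collection of all Mtks (on varying state spaces) that satisfy (A1)-(A3) with this parameter; let $S^{(R)}_{\lambda,K,\varepsilon,\beta}$ be its subcollection of reversible Mtks, and $S^{(N)}_{\lambda,K,\varepsilon,\beta}$ its subcollection of reversible and non-negative definite Mtks, so $S^{(N)}\subset S^{(R)}\subset S$. (For set-theoretic reasons, the state spaces are taken from some fixed set of measurable spaces, which includes at least all finite sets of integers.) Let $\rho_{\mathrm{opt}}$, $\rho^{(R)}_{\mathrm{opt}}$, $\rho^{(N)}_{\mathrm{opt}}$ at $(\lambda,K,\varepsilon,\beta)$ be the supremum of $\rho_*(Q)$ over $Q$ in $S_{\lambda,K,\varepsilon,\beta}$, $S^{(R)}_{\lambda,K,\varepsilon,\beta}$, $S^{(N)}_{\lambda,K,\varepsilon,\beta}$ respectively. For an Mtk $P$ with $T(P)\ne\emptyset$, the chain-specific optimal bound is $\rho^*_{\mathrm{opt}}(P)=\inf_{(\lambda,K,\varepsilon,\beta)\in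 T(P)}r(\lambda,K,\varepsilon,\beta)$, where $r=\rho^{(N)}_{\mathrm{opt}}$ if $P$ is reversible and non-negative definite, $r=\rho^{(R)}_{\mathrm{opt}}$ if $P$ is reversible but not non-negative definite, and $r=\rho_{\mathrm{opt}}$ if $P$ is not reversible. For $C\in\mathcal B$, $\varepsilon_C$ is the supremum of all $\varepsilon\in(0,1]$ for which there is a probability measure $\nu$ on $\mathcal B$ with $P(x,A)\ge\varepsilon\nu(A)$ for all $x\in C$, $A\in\mathcal B$; $\varepsilon_C=0$ if no such $\varepsilon$ exists. $\lfloor\cdot\rfloor$ is the floor function. *)

theory Defs
  imports "HOL-Probability.Probability"
begin

text \<open>Throughout, a measurable space is represented by a \<open>'a measure\<close> of which only the underlying
  set and the sigma-algebra are used.\<close>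

definition countably_generated :: "'a measure \<Rightarrow> bool" where
  "countably_generated M \<longleftrightarrow>
     (\<exists>G. countable G \<and> G \<subseteq> Pow (space M) \<and> sets M = sigma_sets (space M) G)"

definition mtk :: "'a measure \<Rightarrow> ('a \<Rightarrow> 'a measure) \<Rightarrow> bool" where
  "mtk M P \<longleftrightarrow> countably_generated M \<and> P \<in> M \<rightarrow>\<^sub>M prob_algebra M"

primrec kernel_pow :: "'a measure \<Rightarrow> ('a \<Rightarrow> 'a measure) \<Rightarrow> nat \<Rightarrow> 'a \<Rightarrow> 'a measure" where
  "kernel_pow M P 0 x = return M x"
| "kernel_pow M P (Suc m) x = kernel_pow M P m x \<bind> P"

definition stationary :: "'a measure \<Rightarrow> ('a \<Rightarrow> 'a measure) \<Rightarrow> 'a measure \<Rightarrow> bool" where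
  "stationary M P \<pi> \<longleftrightarrow> \<pi> \<in> space (prob_algebra M) \<and> \<pi> \<bind> P = \<pi>"

definition tv_dist :: "'a measure \<Rightarrow> 'a measure \<Rightarrow> real" where
  "tv_dist \<mu> \<nu> = (SUP A\<in>sets \<mu>. measure \<mu> A - measure \<nu> A)"

text \<open>Logarithm and exponential with \<open>log 0 = -\<infinity>\<close> and \<open>exp (-\<infinity>) = 0\<close>; the logarithm is only
  applied to non-negative reals.\<close>

definition ln_ext :: "real \<Rightarrow> ereal" where
  "ln_ext x = (if x \<le> 0 then -\<infinity> else ereal (ln x))"

definition exp_ext :: "ereal \<Rightarrow> ereal" where
  "exp_ext x = (case x of ereal r \<Rightarrow> ereal (exp r) | PInfty \<Rightarrow> \<infinity> | MInfty \<Rightarrow> 0)"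

definition conv_rate :: "'a measure \<Rightarrow> ('a \<Rightarrow> 'a measure) \<Rightarrow> 'a measure \<Rightarrow> ereal" where
  "conv_rate M P \<pi> =
     exp_ext (SUP x\<in>space M. limsup (\<lambda>m. ln_ext (tv_dist (kernel_pow M P m x) \<pi>) / ereal (real m)))"

type_synonym param = "real \<times> real \<times> real \<times> real"

definition T0 :: "param set" where
  "T0 = {0..<1} \<times> {1..} \<times> {0<..1} \<times> {0<..1}"

text \<open>Since \<open>V \<ge> 1\<close>, \<open>PV\<close> is a (possibly infinite) Lebesgue integral of a non-negative
  function; the drift condition forces it to be finite.\<close>

definition drift_minor :: "'a measure \<Rightarrow> ('a \<Rightarrow> 'a measure) \<Rightarrow> param \<Rightarrow> bool" where
  "drift_minor M P = (\<lambda>(lam, K, eps, bet).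
     \<exists>C V \<nu>. C \<in> sets M \<and> V \<in> borel_measurable M \<and> (\<forall>x\<in>space M. 1 \<le> (V x :: real)) \<and>
       \<nu> \<in> space (prob_algebra M) \<and>
       (\<forall>x\<in>space M. (\<integral>\<^sup>+ y. ennreal (V y) \<partial>P x)
          \<le> ennreal (lam * V x * indicator (space M - C) x + K * indicator C x)) \<and>
       (\<forall>x\<in>C. \<forall>A\<in>sets M. measure (P x) A \<ge> eps * measure \<nu> A) \<and>
       measure \<nu> C \<ge> bet)"

definition params :: "'a measure \<Rightarrow> ('a \<Rightarrow> 'a measure) \<Rightarrow> param set" where
  "params M P = {\<theta> \<in> T0. drift_minor M P \<theta>}"

definition L2 :: "'a measure \<Rightarrow> ('a \<Rightarrow> real) set" where
  "L2 \<pi> = {f \<in> borel_measurable \<pi>. integrable \<pi> (\<lambda>x. (f x)\<^sup>2)}"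

text \<open>For \<open>f\<close> in \<open>L2 \<pi>\<close> with \<open>\<pi>\<close> stationary, \<open>f\<close> is \<open>P x\<close>-integrable for \<open>\<pi>\<close>-almost every \<open>x\<close>;
  the value 0 that the Bochner integral takes at the remaining \<open>x\<close> is immaterial.\<close>

definition kernel_app :: "('a \<Rightarrow> 'a measure) \<Rightarrow> ('a \<Rightarrow> real) \<Rightarrow> 'a \<Rightarrow> real" where
  "kernel_app P f x = (\<integral>y. f y \<partial>P x)"

definition reversible :: "('a \<Rightarrow> 'a measure) \<Rightarrow> 'a measure \<Rightarrow> bool" where
  "reversible P \<pi> \<longleftrightarrow>
     (\<forall>f\<in>L2 \<pi>. \<forall>g\<in>L2 \<pi>. (\<integral>x. g x * kernel_app P f x \<partial>\<pi>) = (\<integral>x. f x * kernel_app P g x \<partial>\<pi>))"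

definition nonneg_definite :: "('a \<Rightarrow> 'a measure) \<Rightarrow> 'a measure \<Rightarrow> bool" where
  "nonneg_definite P \<pi> \<longleftrightarrow> (\<forall>f\<in>L2 \<pi>. (\<integral>x. f x * kernel_app P f x \<partial>\<pi>) \<ge> 0)"

text \<open>The state spaces range over a set \<open>U\<close> of measurable spaces, all living in one type \<open>'u\<close>
  (large enough for any given set of spaces), which contains the finite discrete spaces formed
  by a copy of the integers inside \<open>'u\<close>.\<close>

definition has_finite_int_spaces :: "'u measure set \<Rightarrow> bool" where
  "has_finite_int_spaces U \<longleftrightarrow>
     (\<exists>e :: int \<Rightarrow> 'u. inj e \<and> (\<forall>A. finite A \<longrightarrow> (\<exists>M\<in>U. sets M = Pow (e ` A))))"

text \<open>Each Mtk is listed together with its state space and its stationary distribution, which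
  exists and is unique under the drift and minorization conditions.\<close>

type_synonym 'u chain = "'u measure \<times> ('u \<Rightarrow> 'u measure) \<times> 'u measure"

definition S :: "'u measure set \<Rightarrow> param \<Rightarrow> 'u chain set" where
  "S U \<theta> = {(M, Q, \<pi>). M \<in> U \<and> mtk M Q \<and> \<theta> \<in> params M Q \<and> stationary M Q \<pi>}"

definition S_R :: "'u measure set \<Rightarrow> param \<Rightarrow> 'u chain set" where
  "S_R U \<theta> = {(M, Q, \<pi>) \<in> S U \<theta>. reversible Q \<pi>}"

definition S_N :: "'u measure set \<Rightarrow> param \<Rightarrow> 'u chain set" where
  "S_N U \<theta> = {(M, Q, \<pi>) \<in> S U \<theta>. reversible Q \<pi> \<and> nonneg_definite Q \<pi>}"

definition rho_opt :: "'u measure set \<Rightarrow> param \<Rightarrow> ereal" where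
  "rho_opt U \<theta> = (SUP (M, Q, \<pi>)\<in>S U \<theta>. conv_rate M Q \<pi>)"

definition rho_opt_R :: "'u measure set \<Rightarrow> param \<Rightarrow> ereal" where
  "rho_opt_R U \<theta> = (SUP (M, Q, \<pi>)\<in>S_R U \<theta>. conv_rate M Q \<pi>)"

definition rho_opt_N :: "'u measure set \<Rightarrow> param \<Rightarrow> ereal" where
  "rho_opt_N U \<theta> = (SUP (M, Q, \<pi>)\<in>S_N U \<theta>. conv_rate M Q \<pi>)"

definition rho_opt_chain ::
    "'u measure set \<Rightarrow> 'a measure \<Rightarrow> ('a \<Rightarrow> 'a measure) \<Rightarrow> 'a measure \<Rightarrow> ereal" where
  "rho_opt_chain U X P \<pi> =
     (INF \<theta>\<in>params X P.
        if reversible P \<pi> \<and> nonneg_definite P \<pi> then rho_opt_N U \<theta>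
        else if reversible P \<pi> then rho_opt_R U \<theta>
        else rho_opt U \<theta>)"

definition minor_consts :: "'a measure \<Rightarrow> ('a \<Rightarrow> 'a measure) \<Rightarrow> 'a set \<Rightarrow> real set" where
  "minor_consts M P C =
     {eps \<in> {0<..1}. \<exists>\<nu>\<in>space (prob_algebra M).
        \<forall>x\<in>C. \<forall>A\<in>sets M. measure (P x) A \<ge> eps * measure \<nu> A}"

definition eps_C :: "'a measure \<Rightarrow> ('a \<Rightarrow> 'a measure) \<Rightarrow> 'a set \<Rightarrow> real" where
  "eps_C M P C = (if minor_consts M P C = {} then 0 else Sup (minor_consts M P C))"

end

theory Submission
  imports Defs
begin

text \<open>
  A parameter \<open>(\<lambda>, K, \<epsilon>, \<beta>)\<close> of \<open>P\<close> limits two things: how rarely the stationary chain may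
  visit the small set \<open>C\<close>, and how seldom it regenerates there. A finite
  chain with the same parameter can stay away from its small set for as long and regenerate as
  seldom until it is absorbed, and that chain is slow.

  Let \<open>\<pi>\<close> be the stationary distribution and \<open>n = \<lfloor>1 / \<pi>(C)\<rfloor>\<close>. By Jensen's inequality the drift
  condition for \<open>V\<close> becomes an additive one for \<open>log V\<close>: off \<open>C\<close> the function \<open>log V\<close> decreases on
  average by at least \<open>log (1/\<lambda>)\<close>, and from \<open>C\<close> it can rise to at most \<open>log K\<close>. In stationarity
  the losses and the gains balance, so \<open>log (1/\<lambda>) (1 - \<pi>(C)) \<le> log K \<cdot> \<pi>(C)\<close>
  (\<open>stationary_drift_excursion_bound\<close>). Hence \<open>n - 1 \<le> log K / log (1/\<lambda>)\<close>, that is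
  \<open>1 \<le> \<lambda>^(n - 1) K\<close> (\<open>stationary_small_set_mass\<close>).

  This inequality is exactly what permits deterministic excursions of length \<open>n\<close> under the
  same \<open>\<lambda>\<close> and \<open>K\<close>. Take states \<open>0, \<dots>, n\<close> with \<open>0\<close> absorbing, let \<open>k\<close> move to \<open>k - 1\<close> for \<open>k \<ge> 2\<close>,
  and let \<open>1\<close> move to \<open>0\<close> with probability \<open>\<epsilon>\<close> and back to \<open>n\<close> otherwise. With \<open>C = {0, 1}\<close>,
  \<open>\<nu> = \<delta>\<^sub>0\<close>, \<open>V(0) = 1\<close> and \<open>V(k) = \<lambda>^(1 - k)\<close> for \<open>k \<ge> 1\<close>, all three conditions hold, with \<open>\<nu>(C) = 1 \<ge> \<beta>\<close>.
  The stationary distribution is \<open>\<delta>\<^sub>0\<close>, on which every kernel fixing \<open>0\<close> acts as the identity, so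
  the chain is reversible and non-negative definite for trivial reasons; a single example thus
  serves all three classes of chains. It survives each loop of length \<open>n\<close> with
  probability \<open>1 - \<epsilon>\<close>, so its rate is at least \<open>(1 - \<epsilon>)^(1/n)\<close> (\<open>conv_rate_kernel\<close>).

  As \<open>\<epsilon> \<le> \<epsilon>\<^sub>C\<close>, the rate is at least the term that \<open>C\<close> contributes to the infimum.
\<close>

section \<open>Stationary mass of the small set\<close>

text \<open>The truncation at \<open>k\<close> keeps the function bounded, so that it can be integrated against the
  stationary distribution without knowing that \<open>V\<close> or \<open>ln V\<close> is integrable there. The bound by
  \<open>ln s\<close> is Jensen's inequality in the form of the tangent \<open>ln v \<le> v / s - 1 + ln s\<close>.\<close>

lemma nn_integral_truncated_ln_le:
  fixes V :: "'a \<Rightarrow> real"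
  assumes "prob_space N" and V[measurable]: "V \<in> borel_measurable N"
    and V_ge: "\<And>y. y \<in> space N \<Longrightarrow> 1 \<le> V y"
    and mean: "(\<integral>\<^sup>+ y. ennreal (V y) \<partial>N) \<le> ennreal s"
  shows "(\<integral>\<^sup>+ y. ennreal (min (ln (V y)) (real k)) \<partial>N) \<le> ennreal (min (ln s) (real k))"
proof -
  interpret prob_space N by fact
  have V_int: "integrable N V"
  proof (rule integrableI_nonneg)
    show "AE y in N. 0 \<le> V y" using V_ge by (intro AE_I2) force
    show "(\<integral>\<^sup>+ y. ennreal (V y) \<partial>N) < \<infinity>" using mean by (simp add: le_less_trans)
  qed simp
  have "1 \<le> (\<integral>y. V y \<partial>N)"
    by (rule integral_ge_const[OF V_int]) (auto intro!: AE_I2 V_ge)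
  moreover have "ennreal (\<integral>y. V y \<partial>N) \<le> ennreal s"
    using mean nn_integral_eq_integral[OF V_int] V_ge
    by (metis (mono_tags, lifting) AE_I2 order_trans zero_le_one)
  ultimately have s: "1 \<le> s" and V_mean: "(\<integral>y. V y \<partial>N) \<le> s"
    by (auto simp: ennreal_le_iff2)
  let ?f = "\<lambda>y. min (ln (V y)) (real k)"
  have f_nonneg: "0 \<le> ?f y" if "y \<in> space N" for y
    using V_ge[OF that] by simp
  have f_int: "integrable N ?f"
    by (rule integrable_const_bound[where B = "real k"]) (use f_nonneg in \<open>auto intro!: AE_I2\<close>)
  have "?f y \<le> V y / s - 1 + ln s" if "y \<in> space N" for y
    using ln_le_minus_one[of "V y / s"] V_ge[OF that] s by (simp add: ln_div)
  then have "(\<integral>y. ?f y \<partial>N) \<le> (\<integral>y. V y / s - 1 + ln s \<partial>N)"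
    by (intro integral_mono f_int) (use V_int in auto)
  also have "\<dots> = (\<integral>y. V y \<partial>N) / s - 1 + ln s"
    using V_int by (simp add: prob_space)
  also have "\<dots> \<le> ln s"
    using V_mean s by simp
  finally have "(\<integral>y. ?f y \<partial>N) \<le> ln s" .
  moreover have "(\<integral>y. ?f y \<partial>N) \<le> real k"
    by (rule integral_le_const[OF f_int]) simp
  ultimately show ?thesis
    using nn_integral_eq_integral[OF f_int] f_nonneg by (simp add: AE_I2 ennreal_leI)
qed

text \<open>Stationarity gives \<open>\<integral> P f d\<pi> = \<integral> f d\<pi>\<close> for \<open>f = min (ln V) k\<close>, while the drift condition makes
  \<open>P f\<close> at most \<open>f - ln (1 / lam)\<close> off \<open>C\<close> where \<open>ln V \<le> k\<close>, at most \<open>f\<close> off \<open>C\<close> elsewhere, and at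
  most \<open>ln K\<close> on \<open>C\<close>. Cancelling \<open>\<integral> f d\<pi>\<close> and letting \<open>k\<close> tend to infinity leaves the claim.\<close>

lemma stationary_drift_excursion_bound:
  fixes V :: "'a \<Rightarrow> real"
  assumes P: "P \<in> X \<rightarrow>\<^sub>M prob_algebra X" and stat: "stationary X P \<pi>"
    and C[measurable]: "C \<in> sets X" and V[measurable]: "V \<in> borel_measurable X"
    and V_ge: "\<And>x. x \<in> space X \<Longrightarrow> 1 \<le> V x"
    and drift: "\<And>x. x \<in> space X \<Longrightarrow> (\<integral>\<^sup>+ y. ennreal (V y) \<partial>P x)
          \<le> ennreal (lam * V x * indicator (space X - C) x + K * indicator C x)"
    and lam: "0 < lam" "lam < 1" and K: "1 \<le> K"
  shows "ln (1 / lam) * measure \<pi> (space X - C) \<le> ln K * measure \<pi> C"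
proof -
  have sets_\<pi>[measurable_cong]: "sets \<pi> = sets X" and "prob_space \<pi>" and \<pi>_bind: "\<pi> \<bind> P = \<pi>"
    using stat by (auto simp: stationary_def space_prob_algebra)
  interpret prob_space \<pi> by fact
  have space_\<pi>: "space \<pi> = space X"
    using sets_\<pi> by (rule sets_eq_imp_space_eq)
  have P': "P \<in> \<pi> \<rightarrow>\<^sub>M subprob_algebra X"
    using measurable_prob_algebraD[OF P] by (simp cong: measurable_cong_sets)
  define f where "f k x = ennreal (min (ln (V x)) (real k))" for k :: nat and x
  define D where "D k = {x \<in> space X - C. ln (V x) \<le> real k}" for k :: nat
  have f_meas[measurable]: "f k \<in> borel_measurable X" for k
    unfolding f_def by measurable
  have D_meas[measurable]: "D k \<in> sets X" for k
    unfolding D_def by measurable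
  have a: "0 < ln (1 / lam)" using lam by simp
  \<comment> \<open>The gain and the loss are moved to opposite sides, so that all terms are non-negative.\<close>
  have pointwise: "(\<integral>\<^sup>+ y. f k y \<partial>P x) + ennreal (ln (1 / lam)) * indicator (D k) x
      \<le> f k x + ennreal (ln K) * indicator C x" if x: "x \<in> space X" for k x
  proof -
    have Px: "prob_space (P x)" "sets (P x) = sets X"
      using measurable_space[OF P x] by (auto simp: space_prob_algebra)
    have bound: "(\<integral>\<^sup>+ y. f k y \<partial>P x) \<le> ennreal (min (ln s) (real k))"
      if "(\<integral>\<^sup>+ y. ennreal (V y) \<partial>P x) \<le> ennreal s" for s
      unfolding f_def using Px V_ge that sets_eq_imp_space_eq[OF Px(2)]
      by (intro nn_integral_truncated_ln_le) (auto cong: measurable_cong_sets)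
    show ?thesis
    proof (cases "x \<in> C")
      case True
      have "(\<integral>\<^sup>+ y. f k y \<partial>P x) \<le> ennreal (min (ln K) (real k))"
        using drift[OF x] True by (intro bound) simp
      also have "\<dots> \<le> ennreal (ln K)" by (intro ennreal_leI) simp
      finally show ?thesis using True by (simp add: D_def add_increasing)
    next
      case False
      have le: "(\<integral>\<^sup>+ y. f k y \<partial>P x) \<le> ennreal (min (ln (lam * V x)) (real k))"
        using drift[OF x] x False by (intro bound) simp
      \<comment> \<open>Off \<open>C\<close> the next value of \<open>V\<close> has mean at most \<open>lam * V x\<close>, yet it is at least \<open>1\<close>;
        so subtracting \<open>ln (1 / lam)\<close> from \<open>ln (V x)\<close> stays non-negative and does not get cut
        off at \<open>0\<close> in the extended non-negative reals.\<close>
      have "1 \<le> lam * V x"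
      proof -
        interpret Px: prob_space "P x" by fact
        have "(1::ennreal) = (\<integral>\<^sup>+ y. 1 \<partial>P x)" by (simp add: Px.emeasure_space_1)
        also have "\<dots> \<le> (\<integral>\<^sup>+ y. ennreal (V y) \<partial>P x)"
          using V_ge sets_eq_imp_space_eq[OF Px(2)] by (intro nn_integral_mono) simp
        also have "\<dots> \<le> ennreal (lam * V x)" using drift[OF x] x False by simp
        finally show ?thesis by simp
      qed
      then have "0 \<le> ln (lam * V x)" by simp
      moreover have "ln (lam * V x) = ln (V x) - ln (1 / lam)"
        using lam V_ge[OF x] by (simp add: ln_mult ln_div)
      ultimately show ?thesis
        using le a False x add_right_mono[OF le, of "ennreal (ln (1 / lam))"]
        by (cases "x \<in> D k")
           (auto simp: D_def f_def ennreal_plus[symmetric] simp del: ennreal_plus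
                 elim!: order_trans intro!: ennreal_leI)
    qed
  qed
  have level: "ln (1 / lam) * measure \<pi> (D k) \<le> ln K * measure \<pi> C" for k
  proof -
    have "(\<integral>\<^sup>+ x. f k x \<partial>\<pi>) = (\<integral>\<^sup>+ x. (\<integral>\<^sup>+ y. f k y \<partial>P x) \<partial>\<pi>)"
      using nn_integral_bind[OF f_meas P'] \<pi>_bind by simp
    moreover have "(\<lambda>x. \<integral>\<^sup>+ y. f k y \<partial>P x) \<in> borel_measurable \<pi>"
      using P' by (rule measurable_compose) (rule nn_integral_measurable_subprob_algebra[OF f_meas])
    ultimately have "(\<integral>\<^sup>+ x. f k x \<partial>\<pi>) + ennreal (ln (1 / lam)) * emeasure \<pi> (D k)
        = (\<integral>\<^sup>+ x. (\<integral>\<^sup>+ y. f k y \<partial>P x) + ennreal (ln (1 / lam)) * indicator (D k) x \<partial>\<pi>)"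
      by (simp add: nn_integral_add nn_integral_cmult)
    also have "\<dots> \<le> (\<integral>\<^sup>+ x. f k x + ennreal (ln K) * indicator C x \<partial>\<pi>)"
      by (intro nn_integral_mono pointwise) (simp add: space_\<pi>)
    also have "\<dots> = (\<integral>\<^sup>+ x. f k x \<partial>\<pi>) + ennreal (ln K) * emeasure \<pi> C"
      by (simp add: nn_integral_add nn_integral_cmult)
    finally have *: "(\<integral>\<^sup>+ x. f k x \<partial>\<pi>) + ennreal (ln (1 / lam)) * emeasure \<pi> (D k)
        \<le> (\<integral>\<^sup>+ x. f k x \<partial>\<pi>) + ennreal (ln K) * emeasure \<pi> C" .
    have "(\<integral>\<^sup>+ x. f k x \<partial>\<pi>) \<le> (\<integral>\<^sup>+ x. ennreal (real k) \<partial>\<pi>)"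
      unfolding f_def by (intro nn_integral_mono ennreal_leI) simp
    then have "(\<integral>\<^sup>+ x. f k x \<partial>\<pi>) < top"
      by (rule le_less_trans) (simp add: emeasure_space_1)
    with * have "ennreal (ln (1 / lam)) * emeasure \<pi> (D k) \<le> ennreal (ln K) * emeasure \<pi> C"
      by (auto simp: ennreal_add_left_cancel_le)
    then show ?thesis
      using a K by (simp add: emeasure_eq_measure ennreal_mult[symmetric])
  qed
  have "(\<lambda>k. measure \<pi> (D k)) \<longlonglongrightarrow> measure \<pi> (\<Union>k. D k)"
    by (rule finite_Lim_measure_incseq) (auto simp: incseq_def D_def intro: order_trans)
  moreover have "(\<Union>k. D k) = space X - C"
    unfolding D_def using real_arch_simple by auto
  ultimately have "(\<lambda>k. ln (1 / lam) * measure \<pi> (D k)) \<longlonglongrightarrow> ln (1 / lam) * measure \<pi> (space X - C)"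
    by (auto intro: tendsto_mult_left)
  then show ?thesis
    by (rule LIMSEQ_le_const2) (use level in auto)
qed

text \<open>Since \<open>n \<le> 1 / \<pi>(C)\<close>, the previous bound divided by \<open>\<pi>(C)\<close> gives
  \<open>ln (1 / lam) (n - 1) \<le> ln K\<close>. The multiplicative form below also makes sense for \<open>lam = 0\<close>,
  where it says that \<open>n = 1\<close>: no state off \<open>C\<close> can satisfy the drift condition then.\<close>

lemma stationary_small_set_mass:
  fixes V :: "'a \<Rightarrow> real"
  assumes P: "P \<in> X \<rightarrow>\<^sub>M prob_algebra X" and stat: "stationary X P \<pi>"
    and C[measurable]: "C \<in> sets X" and V[measurable]: "V \<in> borel_measurable X"
    and V_ge: "\<And>x. x \<in> space X \<Longrightarrow> 1 \<le> V x"
    and drift: "\<And>x. x \<in> space X \<Longrightarrow> (\<integral>\<^sup>+ y. ennreal (V y) \<partial>P x)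
          \<le> ennreal (lam * V x * indicator (space X - C) x + K * indicator C x)"
    and lam: "0 \<le> lam" "lam < 1" and K: "1 \<le> K"
    and n_def: "n = nat \<lfloor>1 / measure \<pi> C\<rfloor>"
  shows "0 < measure \<pi> C" and "1 \<le> n" and "1 \<le> lam ^ (n - 1) * K"
proof -
  have sets_\<pi>[measurable_cong]: "sets \<pi> = sets X" and "prob_space \<pi>"
    using stat by (auto simp: stationary_def space_prob_algebra)
  interpret prob_space \<pi> by fact
  have space_\<pi>: "space \<pi> = space X"
    using sets_\<pi> by (rule sets_eq_imp_space_eq)
  define p where "p = measure \<pi> C"
  have compl: "measure \<pi> (space X - C) = 1 - p"
    using prob_compl[of C] C by (simp add: space_\<pi> p_def sets_\<pi>)
  have p_le: "p \<le> 1" by (simp add: p_def)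
  have main: "0 < p \<and> 1 \<le> lam ^ (nat \<lfloor>1 / p\<rfloor> - 1) * K"
  proof (cases "lam = 0")
    case True
    have "space X \<subseteq> C"
    proof
      fix x assume x: "x \<in> space X"
      interpret Px: prob_space "P x"
        using measurable_space[OF P x] by (auto simp: space_prob_algebra)
      have "space (P x) = space X"
        using measurable_space[OF P x] by (auto simp: space_prob_algebra dest: sets_eq_imp_space_eq)
      then have "(\<integral>\<^sup>+ y. 1 \<partial>P x) \<le> (\<integral>\<^sup>+ y. ennreal (V y) \<partial>P x)"
        using V_ge by (intro nn_integral_mono) simp
      then show "x \<in> C"
        using drift[OF x] True Px.emeasure_space_1 by (cases "x \<in> C") auto
    qed
    then have "space X - C = {}" by blast
    then have "p = 1" using compl by (metis diff_eq_eq add_0 measure_empty)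
    then show ?thesis using K by simp
  next
    case False
    then have lam_pos: "0 < lam" using lam by simp
    then have a: "0 < ln (1 / lam)" using lam by simp
    have excursion: "ln (1 / lam) * (1 - p) \<le> ln K * p"
      using stationary_drift_excursion_bound[OF P stat C V V_ge drift lam_pos lam(2) K]
      by (simp add: compl p_def)
    have p_pos: "0 < p"
    proof (rule ccontr)
      assume "\<not> 0 < p"
      then have "p = 0" by (simp add: p_def zero_less_measure_iff)
      then show False using excursion a by simp
    qed
    define m where "m = nat \<lfloor>1 / p\<rfloor>"
    have "1 \<le> 1 / p" using p_pos p_le by simp
    then have "1 \<le> \<lfloor>1 / p\<rfloor>" by (simp add: le_floor_iff)
    then have m_ge: "1 \<le> m" unfolding m_def by linarith
    have "real m \<le> 1 / p" unfolding m_def using p_pos by simp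
    then have "real (m - 1) * p \<le> 1 - p"
      using p_pos m_ge by (simp add: field_simps)
    then have "ln (1 / lam) * (real (m - 1) * p) \<le> ln (1 / lam) * (1 - p)"
      using a by (intro mult_left_mono) auto
    with excursion have "(ln (1 / lam) * real (m - 1)) * p \<le> ln K * p"
      by (simp add: mult.assoc)
    then have "ln (1 / lam) * real (m - 1) \<le> ln K"
      using p_pos by simp
    then have "0 \<le> ln (lam ^ (m - 1) * K)"
      using lam_pos K by (simp add: ln_mult ln_div ln_realpow algebra_simps)
    then have "1 \<le> lam ^ (m - 1) * K"
      using lam_pos K by (simp add: ln_ge_zero_iff)
    then show ?thesis using p_pos by (simp add: m_def)
  qed
  then show "0 < measure \<pi> C" and "1 \<le> lam ^ (n - 1) * K"
    by (simp_all add: p_def n_def)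
  then have "1 \<le> \<lfloor>1 / measure \<pi> C\<rfloor>" using p_le by (simp add: p_def le_floor_iff)
  then show "1 \<le> n" unfolding n_def by linarith
qed

section \<open>Lower bounds on convergence rates\<close>

lemma exp_ext_mono: "a \<le> b \<Longrightarrow> exp_ext a \<le> exp_ext b"
  by (cases a; cases b) (auto simp: exp_ext_def)

lemma conv_rate_nonneg: "0 \<le> conv_rate M P \<pi>"
  unfolding conv_rate_def exp_ext_def by (simp split: ereal.split)

text \<open>One starting point is enough, since the rate takes the supremum over all of them, and the
  constant \<open>c\<close> disappears when the logarithm is divided by \<open>m\<close>.\<close>

lemma conv_rate_ge_of_geometric_lower_bound:
  assumes x: "x \<in> space M" and c: "0 < c" and r: "0 < r"
    and tv: "\<And>m. c * r ^ m \<le> tv_dist (kernel_pow M P m x) \<pi>"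
  shows "ereal r \<le> conv_rate M P \<pi>"
proof -
  let ?t = "\<lambda>m. tv_dist (kernel_pow M P m x) \<pi>"
  have "(\<lambda>m. ln c * (1 / real m) + ln r) \<longlonglongrightarrow> ln c * 0 + ln r"
    by (intro tendsto_intros lim_1_over_n)
  then have "(\<lambda>m. ereal (ln c * (1 / real m) + ln r)) \<longlonglongrightarrow> ereal (ln r)"
    by simp
  then have "ereal (ln r) = limsup (\<lambda>m. ereal (ln c * (1 / real m) + ln r))"
    by (intro lim_imp_Limsup[symmetric]) simp_all
  also have "\<dots> \<le> limsup (\<lambda>m. ln_ext (?t m) / ereal (real m))"
  proof (intro Limsup_mono eventually_mono[OF eventually_gt_at_top[of 0]])
    fix m :: nat assume m: "0 < m"
    have pos: "0 < c * r ^ m" using c r by simp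
    then have t_pos: "0 < ?t m" using tv[of m] by linarith
    have "ln c + real m * ln r = ln (c * r ^ m)"
      using c r by (simp add: ln_mult ln_realpow)
    also have "\<dots> \<le> ln (?t m)"
      using tv[of m] pos t_pos by simp
    finally have "(ln c + real m * ln r) / real m \<le> ln (?t m) / real m"
      using m by (simp add: divide_right_mono)
    then show "ereal (ln c * (1 / real m) + ln r) \<le> ln_ext (?t m) / ereal (real m)"
      using m t_pos by (simp add: ln_ext_def add_divide_distrib)
  qed
  also have "\<dots> \<le> (SUP x\<in>space M. limsup (\<lambda>m. ln_ext (tv_dist (kernel_pow M P m x) \<pi>) / ereal (real m)))"
    using x by (rule SUP_upper)
  finally have "exp_ext (ereal (ln r)) \<le> conv_rate M P \<pi>"
    unfolding conv_rate_def by (rule exp_ext_mono)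
  then show ?thesis using r by (simp add: exp_ext_def)
qed

lemma kernel_pow_in_prob_algebra:
  assumes "P \<in> M \<rightarrow>\<^sub>M prob_algebra M" and "x \<in> space M"
  shows "kernel_pow M P m x \<in> space (prob_algebra M)"
proof (induction m)
  case 0
  show ?case using assms(2) by (simp add: space_prob_algebra prob_space_return)
next
  case (Suc m)
  show ?case
    using prob_space_bind'[OF Suc assms(1)] sets_bind'[OF Suc assms(1)]
    by (simp add: space_prob_algebra)
qed

lemma nn_integral_kernel_pow_eigenfunction:
  fixes h :: "'a \<Rightarrow> real"
  assumes P: "P \<in> M \<rightarrow>\<^sub>M prob_algebra M" and x: "x \<in> space M"
    and h[measurable]: "h \<in> borel_measurable M" and r: "0 \<le> r"
    and eigen: "\<And>y. y \<in> space M \<Longrightarrow> (\<integral>\<^sup>+ z. ennreal (h z) \<partial>P y) = ennreal (r * h y)"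
  shows "(\<integral>\<^sup>+ z. ennreal (h z) \<partial>kernel_pow M P m x) = ennreal (r ^ m * h x)"
proof (induction m)
  case 0
  show ?case using x by (simp add: nn_integral_return)
next
  case (Suc m)
  have sets_m[measurable_cong]: "sets (kernel_pow M P m x) = sets M"
    using kernel_pow_in_prob_algebra[OF P x] by (simp add: space_prob_algebra)
  have "(\<integral>\<^sup>+ z. ennreal (h z) \<partial>kernel_pow M P (Suc m) x)
      = (\<integral>\<^sup>+ y. (\<integral>\<^sup>+ z. ennreal (h z) \<partial>P y) \<partial>kernel_pow M P m x)"
    using measurable_prob_algebraD[OF P]
    by (simp add: nn_integral_bind[where B = M] cong: measurable_cong_sets)
  also have "\<dots> = (\<integral>\<^sup>+ y. ennreal r * ennreal (h y) \<partial>kernel_pow M P m x)"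
    using eigen sets_eq_imp_space_eq[OF sets_m] r
    by (intro nn_integral_cong) (simp add: ennreal_mult')
  also have "\<dots> = ennreal r * ennreal (r ^ m * h x)"
    by (simp add: nn_integral_cmult Suc)
  finally show ?case
    using r by (simp add: ennreal_mult'[symmetric] mult.assoc)
qed

lemma tv_dist_ge:
  assumes "prob_space \<mu>" "prob_space \<nu>" "A \<in> sets \<mu>"
  shows "measure \<mu> A - measure \<nu> A \<le> tv_dist \<mu> \<nu>"
proof -
  have "bdd_above ((\<lambda>A. measure \<mu> A - measure \<nu> A) ` sets \<mu>)"
    by (rule bdd_aboveI2[of _ _ 1])
       (meson assms(1) diff_le_eq le_add_same_cancel1 measure_nonneg order_trans prob_space.prob_le_1)
  then show ?thesis
    unfolding tv_dist_def using assms(3) by (rule cSUP_upper2) simp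
qed

section \<open>A cycle with regeneration at an absorbing state\<close>

text \<open>The state \<open>k\<close> is represented by the point \<open>e k\<close>. Regeneration means moving from state \<open>1\<close> to
  the absorbing state \<open>0\<close>; otherwise state \<open>1\<close> starts another loop at \<open>n\<close>.\<close>

locale regenerating_cycle =
  fixes M :: "'u measure" and e :: "nat \<Rightarrow> 'u" and n :: nat and eps :: real
  assumes sets_M: "sets M = Pow (e ` {..n})" and inj_e: "inj e" and n_ge: "1 \<le> n"
    and eps_pos: "0 < eps" and eps_le: "eps \<le> 1"
begin

definition successor :: "nat \<Rightarrow> bool \<Rightarrow> nat" where
  "successor k regen = (if k = 0 then 0 else if k = 1 then if regen then 0 else n else k - 1)"

text \<open>One coin flip is made in every state, but only state \<open>1\<close> uses its outcome; integrals against
  the kernel then become integrals over a Bernoulli variable uniformly in the state.\<close>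

definition kernel :: "'u \<Rightarrow> 'u measure" where
  "kernel y = distr (measure_pmf (bernoulli_pmf eps)) M (\<lambda>regen. e (successor (inv e y) regen))"

abbreviation absorbed :: "'u measure" where
  "absorbed \<equiv> return M (e 0)"

lemma space_M: "space M = e ` {..n}"
  using sets_M sets.sets_into_space[OF sets.top, of M] sets.top[of M] sets.sets_into_space[of "e ` {..n}" M]
  by auto

lemma measurable_from_M: "f \<in> M \<rightarrow>\<^sub>M N \<longleftrightarrow> f \<in> space M \<rightarrow> space N"
  unfolding measurable_def using sets_M space_M by auto

lemma inv_e: "inv e (e k) = k"
  using inj_e by (rule inv_f_f)

lemma e_inj: "e i = e j \<longleftrightarrow> i = j"
  using inj_e by (rule inj_eq)

lemma successor_le: "k \<le> n \<Longrightarrow> successor k regen \<le> n"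
  by (auto simp: successor_def)

lemma measurable_successor:
  "k \<le> n \<Longrightarrow> (\<lambda>regen. e (successor k regen)) \<in> measure_pmf (bernoulli_pmf eps) \<rightarrow>\<^sub>M M"
  using successor_le by (auto simp: space_M)

lemma e_in_space: "k \<le> n \<Longrightarrow> e k \<in> space M"
  by (simp add: space_M)

lemma kernel_in_prob_algebra: "y \<in> space M \<Longrightarrow> kernel y \<in> space (prob_algebra M)"
  unfolding kernel_def
  by (auto simp: space_prob_algebra space_M inv_e
           intro!: measure_pmf.prob_space_distr measurable_successor[unfolded space_M])

lemma kernel_measurable: "kernel \<in> M \<rightarrow>\<^sub>M prob_algebra M"
  using kernel_in_prob_algebra by (simp add: measurable_from_M)

lemma mtk_kernel: "mtk M kernel"
proof -
  have "countable (sets M)"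
    by (simp add: sets_M countable_finite)
  then have "countably_generated M"
    unfolding countably_generated_def
    using sets.space_closed[of M] sets.sigma_sets_eq[of M] by metis
  then show ?thesis using kernel_measurable by (simp add: mtk_def)
qed

lemma nn_integral_kernel:
  fixes f :: "'u \<Rightarrow> ennreal"
  assumes "k \<le> n"
  shows "(\<integral>\<^sup>+ z. f z \<partial>kernel (e k))
    = f (e (successor k True)) * ennreal eps + f (e (successor k False)) * ennreal (1 - eps)"
  unfolding kernel_def inv_e
  using assms eps_pos eps_le
  by (subst nn_integral_distr[OF measurable_successor]) (auto simp: measurable_from_M)

lemma kernel_absorbing: "kernel (e 0) = absorbed"
  using e_in_space[of 0] by (simp add: kernel_def inv_e successor_def measure_pmf.distr_const)

lemma stationary_absorbed: "stationary M kernel absorbed"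
  using e_in_space[of 0] measurable_prob_algebraD[OF kernel_measurable]
  by (simp add: stationary_def space_prob_algebra prob_space_return bind_return kernel_absorbing)

lemma integral_absorbed:
  fixes f :: "'u \<Rightarrow> real"
  shows "(\<integral>y. f y \<partial>absorbed) = f (e 0)"
  by (rule integral_return) (auto simp: measurable_from_M e_in_space)

text \<open>Integration against \<open>absorbed\<close> evaluates at \<open>e 0\<close>, where the kernel does nothing: the two
  quadratic forms are \<open>f (e 0) * g (e 0)\<close> and \<open>(f (e 0))\<^sup>2\<close>.\<close>

lemma reversible_absorbed: "reversible kernel absorbed"
  by (simp add: reversible_def kernel_app_def integral_absorbed kernel_absorbing)

lemma nonneg_definite_absorbed: "nonneg_definite kernel absorbed"
  by (simp add: nonneg_definite_def kernel_app_def integral_absorbed kernel_absorbing)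

text \<open>Going down the cycle, \<open>V\<close> contracts by exactly \<open>lam\<close>; so it must be \<open>(1 / lam)^(n - 1)\<close> at the
  top, and the first assumption on \<open>K\<close> allows the jump to it from state \<open>1\<close>.\<close>

lemma drift_minor_kernel:
  assumes lam: "0 \<le> lam" "lam < 1" and K: "1 \<le> lam ^ (n - 1) * K" and K_ge: "1 \<le> K" and bet: "bet \<le> 1"
  shows "drift_minor M kernel (lam, K, eps, bet)"
proof -
  define C where "C = {e 0, e 1}"
  \<comment> \<open>Truncated subtraction gives \<open>V = 1\<close> at both states of \<open>C\<close>.\<close>
  define V where "V y = (1 / lam) ^ (inv e y - 1)" for y
  have lam_zero: "lam = 0 \<Longrightarrow> n = 1"
    using K n_ge by (cases "n = 1") (auto simp: power_0_left)
  have lam_pow: "lam ^ (n - 1) > 0"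
    using lam lam_zero by (cases "lam = 0") auto
  have V_n: "(1 / lam) ^ (n - 1) \<le> K"
    using K lam_pow by (simp add: power_one_over field_simps)
  have C: "C \<in> sets M" using n_ge by (auto simp: C_def sets_M)
  have V_ge: "1 \<le> V (e k)" if "k \<le> n" for k
  proof (cases "k \<le> 1")
    case True
    then show ?thesis by (simp add: V_def inv_e)
  next
    case False
    then have "0 < lam" using lam(1) lam_zero that by (cases "lam = 0") auto
    then show ?thesis unfolding V_def using lam(2) by (intro one_le_power) simp
  qed
  have minor: "eps * measure absorbed A \<le> measure (kernel y) A" if "y \<in> C" "A \<in> sets M" for y A
  proof -
    obtain k where k: "y = e k" "k \<le> 1" using \<open>y \<in> C\<close> by (auto simp: C_def)
    interpret K: prob_space "kernel y"
      using kernel_in_prob_algebra[of y] k n_ge by (auto simp: space_prob_algebra e_in_space)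
    have "successor k True = 0" using k by (auto simp: successor_def)
    have "A \<in> sets (kernel y)" using that by (simp add: kernel_def)
    then have "ennreal (measure (kernel y) A) = (\<integral>\<^sup>+ z. indicator A z \<partial>kernel (e k))"
      using K.emeasure_eq_measure[of A] by (simp add: k)
    also have "\<dots> \<ge> indicator A (e 0) * ennreal eps"
      using k n_ge \<open>successor k True = 0\<close> by (subst nn_integral_kernel) auto
    finally show ?thesis
      using that eps_pos by (auto simp: measure_return indicator_def split: if_splits)
  qed
  have drift: "(\<integral>\<^sup>+ z. ennreal (V z) \<partial>kernel (e k))
      \<le> ennreal (lam * V (e k) * indicator (space M - C) (e k) + K * indicator C (e k))"
    if k: "k \<le> n" for k
  proof -
    have "(\<integral>\<^sup>+ z. ennreal (V z) \<partial>kernel (e k))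
        = ennreal (V (e (successor k True)) * eps + V (e (successor k False)) * (1 - eps))"
      using k eps_pos eps_le lam
      by (subst nn_integral_kernel)
         (auto simp: ennreal_mult' V_def)
    also have "\<dots> \<le> ennreal (lam * V (e k) * indicator (space M - C) (e k) + K * indicator C (e k))"
    proof (rule ennreal_leI)
      consider "k = 0" | "k = 1" | "2 \<le> k" by linarith
      then show "V (e (successor k True)) * eps + V (e (successor k False)) * (1 - eps)
          \<le> lam * V (e k) * indicator (space M - C) (e k) + K * indicator C (e k)"
      proof cases
        case 1
        then show ?thesis using K_ge by (simp add: successor_def V_def inv_e C_def)
      next
        case 2
        have "eps + (1 / lam) ^ (n - 1) * (1 - eps) \<le> K * eps + K * (1 - eps)"
          using K_ge V_n eps_pos eps_le by (intro add_mono mult_right_mono) auto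
        then show ?thesis using 2
          by (simp add: successor_def V_def inv_e C_def algebra_simps)
      next
        case 3
        then have "lam \<noteq> 0" using lam_zero k by auto
        obtain j where "k = Suc (Suc j)" using 3 by (metis add_2_eq_Suc le_Suc_ex)
        then show ?thesis using \<open>lam \<noteq> 0\<close> k
          by (simp add: successor_def V_def inv_e C_def e_inj e_in_space field_simps)
      qed
    qed
    finally show ?thesis .
  qed
  have "V \<in> borel_measurable M" by (simp add: measurable_from_M)
  moreover have "absorbed \<in> space (prob_algebra M)"
    using e_in_space[of 0] by (simp add: space_prob_algebra prob_space_return)
  moreover have "bet \<le> measure absorbed C"
    using bet C by (simp add: measure_return C_def)
  ultimately show ?thesis
    unfolding drift_minor_def prod.case
    using C V_ge drift minor
    by (intro exI[of _ C] exI[of _ V] exI[of _ absorbed]) (auto simp: space_M)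
qed

text \<open>For \<open>r^n = 1 - eps\<close> the function that is \<open>0\<close> at the absorbing state and \<open>r^(-k)\<close> at state \<open>k\<close>
  is an eigenfunction with eigenvalue \<open>r\<close>: going down it shrinks by \<open>r\<close>, and at state \<open>1\<close> its mean
  after one step is \<open>(1 - eps) r^(-n) = 1\<close>. As it is bounded by \<open>r^(-n)\<close> and vanishes at the
  absorbing state, the mass not yet absorbed after \<open>m\<close> steps is of order at least \<open>r^m\<close>; the
  limit distribution gives none to these states.\<close>

lemma conv_rate_kernel: "ereal ((1 - eps) powr (1 / real n)) \<le> conv_rate M kernel absorbed"
proof (cases "eps = 1")
  case True
  then show ?thesis using conv_rate_nonneg[of M kernel absorbed] by (simp add: zero_ereal_def)
next
  case False
  define r where "r = (1 - eps) powr (1 / real n)"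
  have r_pos: "0 < r" using False eps_le by (simp add: r_def)
  have r_le: "r \<le> 1" using eps_pos eps_le by (simp add: r_def powr_le1)
  have r_n: "r ^ n = 1 - eps"
    using False eps_le n_ge by (simp add: r_def powr_realpow[symmetric] powr_powr)
  define h where "h y = (if y = e 0 then 0 else 1 / r ^ inv e y)" for y
  have h_0: "h (e 0) = 0" by (simp add: h_def)
  have h_nonneg: "0 \<le> h y" for y using r_pos by (simp add: h_def)
  have eigen: "(\<integral>\<^sup>+ z. ennreal (h z) \<partial>kernel y) = ennreal (r * h y)" if y: "y \<in> space M" for y
  proof -
    obtain k where k: "y = e k" "k \<le> n" using y by (auto simp: space_M)
    have "(\<integral>\<^sup>+ z. ennreal (h z) \<partial>kernel y)
        = ennreal (h (e (successor k True)) * eps + h (e (successor k False)) * (1 - eps))"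
      using k h_nonneg eps_pos eps_le
      by (simp add: nn_integral_kernel ennreal_mult')
    also have "h (e (successor k True)) * eps + h (e (successor k False)) * (1 - eps) = r * h y"
    proof -
      consider "k = 0" | "k = 1" | "2 \<le> k" by linarith
      then show ?thesis
      proof cases
        case 1
        then show ?thesis by (simp add: h_def k successor_def)
      next
        case 2
        then show ?thesis using n_ge r_n r_pos False
          by (simp add: h_def k successor_def e_inj inv_e)
      next
        case 3
        obtain j where "k = Suc (Suc j)" using 3 by (metis add_2_eq_Suc le_Suc_ex)
        then show ?thesis using r_pos
          by (simp add: h_def k successor_def e_inj inv_e field_simps)
      qed
    qed
    finally show ?thesis .
  qed
  have tv: "(r ^ n * (1 / r)) * r ^ m \<le> tv_dist (kernel_pow M kernel m (e 1)) absorbed" for m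
  proof -
    let ?\<mu> = "kernel_pow M kernel m (e 1)"
    let ?A = "space M - {e 0}"
    have \<mu>: "prob_space ?\<mu>" "sets ?\<mu> = sets M"
      using kernel_pow_in_prob_algebra[OF kernel_measurable e_in_space[OF n_ge]]
      by (simp_all add: space_prob_algebra)
    interpret \<mu>: prob_space ?\<mu> by fact
    have A: "?A \<in> sets M" by (auto simp: sets_M space_M)
    have h_le: "h y \<le> 1 / r ^ n" if "y \<in> space M" for y
      using that r_pos r_le
      by (auto simp: h_def space_M inv_e intro!: divide_left_mono power_decreasing)
    have "ennreal (r ^ m * (1 / r)) = (\<integral>\<^sup>+ z. ennreal (h z) \<partial>?\<mu>)"
      using nn_integral_kernel_pow_eigenfunction[OF kernel_measurable e_in_space[OF n_ge] _ _ eigen]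
        r_pos by (simp add: measurable_from_M h_def e_inj inv_e)
    also have "\<dots> \<le> (\<integral>\<^sup>+ z. ennreal (1 / r ^ n) * indicator ?A z \<partial>?\<mu>)"
      using h_le sets_eq_imp_space_eq[OF \<mu>(2)]
      by (intro nn_integral_mono) (auto simp: indicator_def h_0 intro!: ennreal_leI)
    also have "\<dots> = ennreal (1 / r ^ n * measure ?\<mu> ?A)"
      using A \<mu>(2) r_pos \<mu>.emeasure_eq_measure[of ?A]
      by (simp add: nn_integral_cmult_indicator ennreal_mult[symmetric])
    finally have "r ^ m * (1 / r) \<le> 1 / r ^ n * measure ?\<mu> ?A"
      using r_pos by (subst (asm) ennreal_le_iff) auto
    then have "(r ^ n * (1 / r)) * r ^ m \<le> measure ?\<mu> ?A"
      using r_pos by (simp add: field_simps)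
    also have "\<dots> = measure ?\<mu> ?A - measure absorbed ?A"
      using A by (simp add: measure_return)
    also have "\<dots> \<le> tv_dist ?\<mu> absorbed"
      using \<mu> A e_in_space[of 0] by (intro tv_dist_ge prob_space_return) auto
    finally show ?thesis .
  qed
  have "0 < r ^ n * (1 / r)" using r_pos by simp
  from conv_rate_ge_of_geometric_lower_bound[OF e_in_space[OF n_ge] this r_pos tv]
  show ?thesis unfolding r_def .
qed

end

section \<open>Comparison of the bounds\<close>

lemma rho_opt_N_ge:
  fixes U :: "'u measure set"
  assumes U: "has_finite_int_spaces U" and \<theta>: "(lam, K, eps, bet) \<in> T0"
    and n: "1 \<le> n" "1 \<le> lam ^ (n - 1) * K"
  shows "ereal ((1 - eps) powr (1 / real n)) \<le> rho_opt_N U (lam, K, eps, bet)"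
proof -
  obtain e :: "int \<Rightarrow> 'u" where "inj e" and e: "\<And>A. finite A \<Longrightarrow> \<exists>M\<in>U. sets M = Pow (e ` A)"
    using U by (auto simp: has_finite_int_spaces_def)
  obtain M where M: "M \<in> U" "sets M = Pow (e ` int ` {..n})"
    using e[of "int ` {..n}"] by auto
  interpret regenerating_cycle M "e \<circ> int" n eps
    using M \<theta> n \<open>inj e\<close> by unfold_locales (auto simp: T0_def image_comp intro: inj_compose)
  have "drift_minor M kernel (lam, K, eps, bet)"
    using \<theta> n by (intro drift_minor_kernel) (auto simp: T0_def)
  then have "(M, kernel, absorbed) \<in> S_N U (lam, K, eps, bet)"
    using \<theta> M mtk_kernel stationary_absorbed reversible_absorbed nonneg_definite_absorbed
    by (simp add: S_N_def S_def params_def)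
  then have "conv_rate M kernel absorbed \<le> rho_opt_N U (lam, K, eps, bet)"
    unfolding rho_opt_N_def by (rule SUP_upper2) simp
  with conv_rate_kernel show ?thesis by (rule order_trans)
qed

lemma rho_opt_N_le_R: "rho_opt_N U \<theta> \<le> rho_opt_R U \<theta>"
  unfolding rho_opt_N_def rho_opt_R_def by (rule SUP_subset_mono) (auto simp: S_N_def S_R_def)

lemma rho_opt_R_le: "rho_opt_R U \<theta> \<le> rho_opt U \<theta>"
  unfolding rho_opt_R_def rho_opt_def by (rule SUP_subset_mono) (auto simp: S_R_def)

lemma minor_consts_le_eps_C: "eps \<in> minor_consts M P C \<Longrightarrow> eps \<le> eps_C M P C"
  unfolding eps_C_def by (auto intro!: cSup_upper bdd_aboveI[of _ 1] simp: minor_consts_def)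

lemma eps_C_le_1: "eps_C M P C \<le> 1"
  unfolding eps_C_def by (auto intro!: cSup_least simp: minor_consts_def)

theorem theorem9:
  fixes X :: "'a measure" and P :: "'a \<Rightarrow> 'a measure" and \<pi> :: "'a measure"
    and U :: "'u measure set"
  assumes "has_finite_int_spaces U"
    and "mtk X P"
    and "params X P \<noteq> {}"
    and "stationary X P \<pi>"
  shows "rho_opt_chain U X P \<pi> \<ge>
    (INF C\<in>{C \<in> sets X. measure \<pi> C > 0}.
       ereal ((1 - eps_C X P C) powr (1 / real_of_int \<lfloor>1 / measure \<pi> C\<rfloor>)))"
proof -
  let ?b = "INF C\<in>{C \<in> sets X. measure \<pi> C > 0}.
       ereal ((1 - eps_C X P C) powr (1 / real_of_int \<lfloor>1 / measure \<pi> C\<rfloor>))"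
  have P: "P \<in> X \<rightarrow>\<^sub>M prob_algebra X" using assms(2) by (simp add: mtk_def)
  have N: "?b \<le> rho_opt_N U \<theta>" if \<theta>: "\<theta> \<in> params X P" for \<theta>
  proof -
    obtain lam K eps bet where \<theta>_eq: "\<theta> = (lam, K, eps, bet)" by (cases \<theta>)
    have T0: "(lam, K, eps, bet) \<in> T0" using \<theta> by (simp add: params_def \<theta>_eq)
    obtain C V \<nu> where C: "C \<in> sets X" and V: "V \<in> borel_measurable X"
      and V_ge: "\<And>x. x \<in> space X \<Longrightarrow> 1 \<le> (V x :: real)"
      and \<nu>: "\<nu> \<in> space (prob_algebra X)"
      and drift: "\<And>x. x \<in> space X \<Longrightarrow> (\<integral>\<^sup>+ y. ennreal (V y) \<partial>P x)
          \<le> ennreal (lam * V x * indicator (space X - C) x + K * indicator C x)"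
      and minor: "\<forall>x\<in>C. \<forall>A\<in>sets X. measure (P x) A \<ge> eps * measure \<nu> A"
      using \<theta> unfolding params_def \<theta>_eq drift_minor_def by auto
    define n where "n = nat \<lfloor>1 / measure \<pi> C\<rfloor>"
    have lamK: "0 \<le> lam" "lam < 1" "1 \<le> K" and eps: "0 < eps" "eps \<le> 1"
      using T0 by (auto simp: T0_def)
    note mass = stationary_small_set_mass[OF P assms(4) C V V_ge drift lamK n_def]
    have "eps \<in> minor_consts X P C"
      using eps \<nu> minor by (auto simp: minor_consts_def)
    then have "eps \<le> eps_C X P C" by (rule minor_consts_le_eps_C)
    have "?b \<le> ereal ((1 - eps_C X P C) powr (1 / real_of_int \<lfloor>1 / measure \<pi> C\<rfloor>))"
      by (rule INF_lower) (use C mass in auto)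
    also have "\<dots> = ereal ((1 - eps_C X P C) powr (1 / real n))"
      using mass(2) by (simp add: n_def)
    also have "\<dots> \<le> ereal ((1 - eps) powr (1 / real n))"
      using \<open>eps \<le> eps_C X P C\<close> eps_C_le_1[of X P C] by (simp add: powr_mono2)
    also have "\<dots> \<le> rho_opt_N U \<theta>"
      unfolding \<theta>_eq using assms(1) T0 mass(2,3) by (rule rho_opt_N_ge)
    finally show ?thesis .
  qed
  have R: "?b \<le> rho_opt_R U \<theta>" if "\<theta> \<in> params X P" for \<theta>
    using N[OF that] rho_opt_N_le_R by (rule order_trans)
  have "?b \<le> rho_opt U \<theta>" if "\<theta> \<in> params X P" for \<theta>
    using R[OF that] rho_opt_R_le by (rule order_trans)
  with N R show ?thesis
    unfolding rho_opt_chain_def by (intro INF_greatest) simp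
qed

end
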